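(* There exists $\gamma'>0$ such that for all $\varepsilon>0$ sufficiently small, for all $n$ sufficiently large (depending on $\varepsilon$), for all $k\in\mathbf N$ for which $\mathbf P\{1\in R_k(T_n)\}\ge 1-\varepsilon$, we also have $$\mathbf P\{\,|R_k(T_n)|\ge \varepsilon^{-\gamma'}\,\}\ \ge\ 1-\varepsilon .$$
   Context: $\mathbf N=\{1,2,3,\dots\}$ and $[n]=\{1,\dots,n\}$; $\log$ is the natural logarithm. Random recursive tree (uniform attachment tree): $T_1$ consists of a single vertex with label $1$. Inductively, $T_{i+1}$ is obtained from $T_i$ by adding a new vertex labelled $i+1$ and joining it by an edge to a vertex of $T_i$ chosen uniformly at random from $[i]$, independently of the past. The root of $T_n$ is vertex $1$. For $n\in\mathbf N$ let $m_n=\lceil e\log n-\tfrac32\log\log(n+1)\rceil$. Leaf-stripping: for $k\in\mathbf N$, view $T_n$ as an unrooted tree and let $T^{(0)}=T_n$. For $1\le i\le m_n-k$, let $T^{(i)}$ be obtained from $T^{(i-1)}$ by simultaneously removing all its leaves. $R_k(T_n)$ is the vertex set of $T^{(m_n-k)}$. Conventions: a leaf is a vertex of degree at most $1$ (so an isolated vertex is removed, and the empty tree stays empty); if $m_n-k\le 0$, no stripping is done and $R_k(T_n)=[n]$. Thus when $m_n-k\ge1$, $1\in R_k(T_n)$ if and only if there are at least two edge-disjoint paths of length at least $m_n-k$ starting from vertex $1$ in $T_n$. *)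

theory Defs
  imports "HOL-Probability.Probability"
begin

text \<open>A finite simple graph is a pair of a vertex set and a set of two-element edges.\<close>

type_synonym ugraph = "nat set \<times> nat set set"

definition vertex_degree :: "ugraph \<Rightarrow> nat \<Rightarrow> nat" where
  "vertex_degree G v = card {e \<in> snd G. v \<in> e}"

text \<open>A leaf has degree at most one; in particular, isolated vertices are leaves.\<close>

definition leaves :: "ugraph \<Rightarrow> nat set" where
  "leaves G = {v \<in> fst G. vertex_degree G v \<le> 1}"

definition strip_leaves :: "ugraph \<Rightarrow> ugraph" where
  "strip_leaves G = (fst G - leaves G, {e \<in> snd G. e \<subseteq> fst G - leaves G})"

definition attach :: "ugraph \<Rightarrow> nat \<Rightarrow> nat \<Rightarrow> ugraph" where
  "attach G v j = (insert v (fst G), insert {j, v} (snd G))"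

text \<open>
  The law of the random recursive tree on the vertices \<open>1, \<dots>, n\<close>. The value at \<open>0\<close> is a
  dummy: the process starts with the single vertex \<open>1\<close>.
\<close>

fun random_recursive_tree :: "nat \<Rightarrow> ugraph pmf" where
  "random_recursive_tree 0 = return_pmf ({}, {})"
| "random_recursive_tree (Suc 0) = return_pmf ({1}, {})"
| "random_recursive_tree (Suc (Suc i)) =
     bind_pmf (random_recursive_tree (Suc i)) (\<lambda>G.
       map_pmf (attach G (Suc (Suc i))) (pmf_of_set {1..Suc i}))"

definition height_bound :: "nat \<Rightarrow> int" where
  "height_bound n = \<lceil>exp 1 * ln (real n) - 3 / 2 * ln (ln (real n + 1))\<rceil>"

text \<open>The conversion \<^const>\<open>nat\<close> maps negative values to \<open>0\<close>, so that nothing is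
  stripped when \<open>height_bound n \<le> k\<close>.\<close>

definition leaf_stripping :: "nat \<Rightarrow> nat \<Rightarrow> ugraph \<Rightarrow> nat set" where
  "leaf_stripping n k G = fst ((strip_leaves ^^ nat (height_bound n - int k)) G)"

lemma fst_random_recursive_tree:
  "G \<in> set_pmf (random_recursive_tree n) \<Longrightarrow> fst G = {1..n}"
proof (induction n arbitrary: G rule: random_recursive_tree.induct)
  case (3 i)
  then obtain H j where "H \<in> set_pmf (random_recursive_tree (Suc i))"
    and "G = attach H (Suc (Suc i)) j"
    by auto
  with "3.IH" show ?case
    by (simp add: attach_def atLeastAtMostSuc_conv)
qed auto

lemma leaf_stripping_subset: "leaf_stripping n k G \<subseteq> fst G"
proof -
  have "fst ((strip_leaves ^^ i) G) \<subseteq> fst G" for i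
    by (induction i) (auto simp: strip_leaves_def)
  then show ?thesis
    by (simp add: leaf_stripping_def)
qed

lemma leaf_stripping_no_rounds:
  "height_bound n \<le> int k \<Longrightarrow> leaf_stripping n k G = fst G"
  by (simp add: leaf_stripping_def)

end

theory Submission
  imports Defs
begin

text \<open>
  Write \<open>m\<close> for the number of stripping rounds and cut the tree at time \<open>M\<close>: each of the first
  \<open>M\<close> vertices then carries its own subtree, consisting of the later vertices whose line of
  ancestors enters \<open>{1..M}\<close> at that vertex. Call one of the first \<open>M\<close> vertices shallow if its
  subtree has height less than \<open>m\<close>. Given the tree on \<open>{1..M}\<close>, the \<open>M\<close> subtrees are exchangeable, and
  their joint law does not depend on the shape of that tree. Let \<open>q\<close> be the common probability of being
  shallow. The proof compares both events of the theorem with \<open>q\<close>, so that no information on the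
  actual height of a random recursive tree is needed.

  \<^item> If vertex \<open>1\<close> is a leaf of the tree on \<open>{1..M}\<close> and is shallow, then no two disjoint long paths
    start from it, so it is stripped (\<open>root_stripped\<close>). The first event has probability
    \<open>1 / (M - 1)\<close> and is independent of the second, so \<open>q \<le> (M - 1) * \<epsilon>\<close> when the root is stripped with
    probability at most \<open>\<epsilon>\<close> (\<open>shallow_prob_le\<close>).

  \<^item> If two of the first \<open>M\<close> vertices are not shallow, then both lie in the middle of a path that
    extends them by at least \<open>m\<close> edges on either side, so both survive (\<open>two_deep_survive\<close>). Take
    \<open>M = 2 * K\<close> and pair \<open>v\<close> with \<open>v + K\<close>. If fewer than \<open>K\<close> vertices survive, some pair consists of two
    shallow vertices.

  \<^item> The subtrees compete for the same new vertices, hence being shallow is negatively correlated for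
    two different vertices, and a given pair is shallow with probability at most \<open>q\<^sup>2\<close>
    (\<open>shallow_negatively_correlated\<close>). This square is what gains over \<open>\<epsilon>\<close>.

  Together, fewer than \<open>K\<close> vertices survive with probability at most
  \<open>K * q\<^sup>2 \<le> 4 * K ^ 3 * \<epsilon>\<^sup>2\<close>. With \<open>K\<close> of order \<open>\<epsilon> powr (- 1 / 4)\<close> this is at most a constant times
  \<open>\<epsilon> powr (5 / 4)\<close>, which is below \<open>\<epsilon>\<close> for small \<open>\<epsilon>\<close>.
\<close>

section \<open>Leaf stripping in an arbitrary finite graph\<close>

lemma strip_leaves_power_edges:
  assumes "\<And>e. e \<in> snd G \<Longrightarrow> e \<subseteq> fst G"
  shows "snd ((strip_leaves ^^ i) G) = {e \<in> snd G. e \<subseteq> fst ((strip_leaves ^^ i) G)}"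
proof (induction i)
  case 0
  then show ?case
    using assms by auto
next
  case (Suc i)
  then show ?case
    by (auto simp: strip_leaves_def)
qed

lemma strip_leaves_power_subset: "fst ((strip_leaves ^^ i) G) \<subseteq> fst G"
  by (induction i) (auto simp: strip_leaves_def)

text \<open>
  Stripping is analysed through local rules only: a vertex with two surviving neighbours is not a
  leaf, and a vertex with one remaining edge is. Iterating the two rules replaces all reasoning about
  paths and distances.
\<close>

lemma survives_round:
  assumes wf: "\<And>e. e \<in> snd G \<Longrightarrow> e \<subseteq> fst G" and "finite (snd G)"
    and "x \<in> fst ((strip_leaves ^^ i) G)"
    and "a \<in> fst ((strip_leaves ^^ i) G)" "{x, a} \<in> snd G"
    and "b \<in> fst ((strip_leaves ^^ i) G)" "{x, b} \<in> snd G"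
    and "a \<noteq> b"
  shows "x \<in> fst ((strip_leaves ^^ Suc i) G)"
proof -
  let ?H = "(strip_leaves ^^ i) G"
  have edges: "snd ?H = {e \<in> snd G. e \<subseteq> fst ?H}"
    by (rule strip_leaves_power_edges) (rule wf)
  have "{{x, a}, {x, b}} \<subseteq> {e \<in> snd ?H. x \<in> e}"
    using assms(3-7) by (auto simp: edges)
  moreover have "finite {e \<in> snd ?H. x \<in> e}"
    using \<open>finite (snd G)\<close> by (simp add: edges)
  ultimately have "card {{x, a}, {x, b}} \<le> vertex_degree ?H x"
    unfolding vertex_degree_def by (rule card_mono[rotated])
  moreover have "{x, a} \<noteq> {x, b}"
    using \<open>a \<noteq> b\<close> by (simp add: doubleton_eq_iff)
  ultimately show ?thesis
    using assms(3) by (simp add: strip_leaves_def leaves_def)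
qed

lemma removed_by_round:
  assumes wf: "\<And>e. e \<in> snd G \<Longrightarrow> e \<subseteq> fst G"
    and single: "\<And>e. \<lbrakk>e \<in> snd G; x \<in> e; e \<subseteq> fst ((strip_leaves ^^ i) G)\<rbrakk> \<Longrightarrow> e = e0"
  shows "x \<notin> fst ((strip_leaves ^^ Suc i) G)"
proof -
  let ?H = "(strip_leaves ^^ i) G"
  have edges: "snd ?H = {e \<in> snd G. e \<subseteq> fst ?H}"
    by (rule strip_leaves_power_edges) (rule wf)
  have "{e \<in> snd ?H. x \<in> e} \<subseteq> {e0}"
    using single by (auto simp: edges)
  then have "vertex_degree ?H x \<le> card {e0}"
    unfolding vertex_degree_def by (rule card_mono[rotated]) simp
  then show ?thesis
    by (simp add: strip_leaves_def leaves_def)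
qed

section \<open>Recursive trees as parent functions\<close>

definition tree_of :: "nat \<Rightarrow> (nat \<Rightarrow> nat) \<Rightarrow> ugraph" where
  "tree_of n \<pi> = ({1..n}, (\<lambda>i. {i, \<pi> i}) ` {2..n})"

definition recursive :: "nat \<Rightarrow> (nat \<Rightarrow> nat) \<Rightarrow> bool" where
  "recursive n \<pi> \<longleftrightarrow> (\<forall>i\<in>{2..n}. 1 \<le> \<pi> i \<and> \<pi> i < i)"

text \<open>
  Sampling the whole parent function keeps the information on the order of arrival, from which
  the subtrees hanging off the first vertices can be read off. The value at \<open>1\<close> and beyond the
  current size is the dummy \<open>0\<close>.
\<close>

fun random_parents :: "nat \<Rightarrow> (nat \<Rightarrow> nat) pmf" where
  "random_parents 0 = return_pmf (\<lambda>_. 0)"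
| "random_parents (Suc 0) = return_pmf (\<lambda>_. 0)"
| "random_parents (Suc (Suc i)) =
     bind_pmf (random_parents (Suc i)) (\<lambda>\<pi>.
       map_pmf (\<lambda>p. \<pi>(Suc (Suc i) := p)) (pmf_of_set {1..Suc i}))"

lemma attach_tree_of:
  "attach (tree_of (Suc i) \<pi>) (Suc (Suc i)) p = tree_of (Suc (Suc i)) (\<pi>(Suc (Suc i) := p))"
proof -
  have "{2..Suc (Suc i)} = insert (Suc (Suc i)) {2..Suc i}"
    "{1..Suc (Suc i)} = insert (Suc (Suc i)) {1..Suc i}"
    by auto
  moreover have "(\<lambda>j. {j, (\<pi>(Suc (Suc i) := p)) j}) ` {2..Suc i} = (\<lambda>j. {j, \<pi> j}) ` {2..Suc i}"
    by (rule image_cong) auto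
  ultimately show ?thesis
    by (simp add: attach_def tree_of_def insert_commute del: fun_upd_apply)
       (simp add: insert_commute)
qed

lemma random_recursive_tree_eq:
  "random_recursive_tree n = map_pmf (tree_of n) (random_parents n)"
proof (induction n rule: random_parents.induct)
  case (3 i)
  have "random_recursive_tree (Suc (Suc i)) =
      bind_pmf (random_parents (Suc i)) (\<lambda>\<pi>.
        map_pmf (attach (tree_of (Suc i) \<pi>) (Suc (Suc i))) (pmf_of_set {1..Suc i}))"
    by (simp add: 3 bind_map_pmf)
  also have "\<dots> = map_pmf (tree_of (Suc (Suc i))) (random_parents (Suc (Suc i)))"
    by (simp add: map_bind_pmf pmf.map_comp o_def attach_tree_of[abs_def] cong: map_pmf_cong)
  finally show ?case .
qed (auto simp: tree_of_def)

lemma recursive_random_parents: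
  "\<pi> \<in> set_pmf (random_parents n) \<Longrightarrow> recursive n \<pi>"
proof (induction n arbitrary: \<pi> rule: random_parents.induct)
  case (3 i)
  then obtain \<pi>' p where "\<pi>' \<in> set_pmf (random_parents (Suc i))" "p \<in> {1..Suc i}"
    and \<pi>: "\<pi> = \<pi>'(Suc (Suc i) := p)"
    by (auto simp: set_pmf_of_set)
  with "3.IH" show ?case
    by (auto simp: recursive_def)
qed (auto simp: recursive_def)

lemma finite_set_pmf_random_parents: "finite (set_pmf (random_parents n))"
  by (induction n rule: random_parents.induct) auto

text \<open>
  Averaging over the parent of the last vertex. All probabilistic statements below are obtained by
  undoing one step of the growth at a time with this identity.
\<close>

lemma expectation_random_parents_Suc:
  fixes g :: "(nat \<Rightarrow> nat) \<Rightarrow> real"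
  assumes "1 \<le> n"
  shows "measure_pmf.expectation (random_parents (Suc n)) g =
    measure_pmf.expectation (random_parents n)
      (\<lambda>\<pi>. (\<Sum>p\<in>{1..n}. g (\<pi>(Suc n := p))) / real n)"
proof -
  obtain i where n: "n = Suc i"
    using assms by (cases n) auto
  have "random_parents (Suc n) = bind_pmf (random_parents n)
      (\<lambda>\<pi>. map_pmf (\<lambda>p. \<pi>(Suc n := p)) (pmf_of_set {1..n}))"
    by (simp add: n)
  also have "measure_pmf.expectation \<dots> g =
    measure_pmf.expectation (random_parents n)
      (\<lambda>\<pi>. measure_pmf.expectation (map_pmf (\<lambda>p. \<pi>(Suc n := p)) (pmf_of_set {1..n})) g)"
    using assms
    by (subst pmf_expectation_bind[OF finite_set_pmf_random_parents _ order.refl])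
       (auto simp: integral_measure_pmf_real[OF finite_set_pmf_random_parents] mult.commute)
  also have "\<dots> = measure_pmf.expectation (random_parents n)
      (\<lambda>\<pi>. (\<Sum>p\<in>{1..n}. g (\<pi>(Suc n := p))) / real n)"
    using assms by (simp add: integral_pmf_of_set)
  finally show ?thesis .
qed

lemma expectation_random_parents_mono:
  fixes f g :: "(nat \<Rightarrow> nat) \<Rightarrow> real"
  assumes "\<And>\<pi>. recursive n \<pi> \<Longrightarrow> f \<pi> \<le> g \<pi>"
  shows "measure_pmf.expectation (random_parents n) f \<le> measure_pmf.expectation (random_parents n) g"
  by (rule integral_mono_AE)
     (auto intro!: integrable_measure_pmf_finite finite_set_pmf_random_parents AE_pmfI assms
           recursive_random_parents)

lemma prob_random_parents:
  "measure_pmf.prob (random_parents n) {\<pi>. P \<pi>} =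
    measure_pmf.expectation (random_parents n) (\<lambda>\<pi>. of_bool (P \<pi>))"
proof -
  have "(\<lambda>\<pi>. of_bool (P \<pi>) :: real) = indicator {\<pi>. P \<pi>}"
    by (auto simp: indicator_def)
  then show ?thesis
    by simp
qed

section \<open>The subtrees hanging off the first vertices\<close>

text \<open>
  The ancestor line of a vertex is followed until it enters \<open>{1..M}\<close>; \<open>origin\<close> is the entry point
  and \<open>depth\<close> the number of steps. The guard \<open>x \<le> \<pi> x\<close> only serves to make the recursion terminate
  for functions that are not parent functions of a recursive tree.
\<close>

fun origin :: "nat \<Rightarrow> (nat \<Rightarrow> nat) \<Rightarrow> nat \<Rightarrow> nat" where
  "origin M \<pi> x = (if x \<le> M \<or> x \<le> \<pi> x then x else origin M \<pi> (\<pi> x))"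

fun depth :: "nat \<Rightarrow> (nat \<Rightarrow> nat) \<Rightarrow> nat \<Rightarrow> nat" where
  "depth M \<pi> x = (if x \<le> M \<or> x \<le> \<pi> x then 0 else Suc (depth M \<pi> (\<pi> x)))"

declare origin.simps [simp del] depth.simps [simp del]

lemma origin_fun_upd: "x < y \<Longrightarrow> origin M (\<pi>(y := p)) x = origin M \<pi> x"
proof (induction x rule: less_induct)
  case (less x)
  show ?case
  proof (cases "x \<le> M \<or> x \<le> \<pi> x")
    case True
    then show ?thesis
      using less.prems by (subst (1 2) origin.simps) auto
  next
    case False
    then have "origin M (\<pi>(y := p)) (\<pi> x) = origin M \<pi> (\<pi> x)"
      using less.prems by (intro less.IH) auto
    then show ?thesis
      using less.prems False by (subst (1 2) origin.simps) auto
  qed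
qed

lemma depth_fun_upd: "x < y \<Longrightarrow> depth M (\<pi>(y := p)) x = depth M \<pi> x"
proof (induction x rule: less_induct)
  case (less x)
  show ?case
  proof (cases "x \<le> M \<or> x \<le> \<pi> x")
    case True
    then show ?thesis
      using less.prems by (subst (1 2) depth.simps) auto
  next
    case False
    then have "depth M (\<pi>(y := p)) (\<pi> x) = depth M \<pi> (\<pi> x)"
      using less.prems by (intro less.IH) auto
    then show ?thesis
      using less.prems False by (subst (1 2) depth.simps) auto
  qed
qed

text \<open>
  A descending chain of \<open>r\<close> edges that uses only vertices beyond \<open>M\<close> below its top. This recursive
  form of the height matches the rounds of stripping, whereas \<open>depth\<close> is what
  changes in a simple way when the tree grows; \<open>shallow_iff\<close> translates between the two.
\<close>

primrec reaches_down :: "nat \<Rightarrow> nat \<Rightarrow> (nat \<Rightarrow> nat) \<Rightarrow> nat \<Rightarrow> nat \<Rightarrow> bool" where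
  "reaches_down M n \<pi> 0 x \<longleftrightarrow> True"
| "reaches_down M n \<pi> (Suc r) x \<longleftrightarrow> (\<exists>c\<in>{Suc M..n}. \<pi> c = x \<and> reaches_down M n \<pi> r c)"

lemma reaches_down_SucD: "reaches_down M n \<pi> (Suc r) x \<Longrightarrow> reaches_down M n \<pi> r x"
proof (induction r arbitrary: x)
  case (Suc r)
  then obtain c where "c \<in> {Suc M..n}" "\<pi> c = x" "reaches_down M n \<pi> (Suc r) c"
    unfolding reaches_down.simps(2)[of M n \<pi> "Suc r"] by blast
  then show ?case
    using Suc.IH[of c] unfolding reaches_down.simps(2) by blast
qed simp

lemma recursive_parent:
  assumes "recursive n \<pi>" "M < x" "x \<le> n" "1 \<le> M"
  shows "1 \<le> \<pi> x" "\<pi> x < x"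
  using assms by (auto simp: recursive_def)

lemma origin_depth_parent:
  assumes "recursive n \<pi>" "M < x" "x \<le> n" "1 \<le> M"
  shows "origin M \<pi> x = origin M \<pi> (\<pi> x)" "depth M \<pi> x = Suc (depth M \<pi> (\<pi> x))"
  using recursive_parent[OF assms] assms(2) origin.simps[of M \<pi> x] depth.simps[of M \<pi> x]
  by auto

lemma reaches_down_imp_deep:
  assumes "recursive n \<pi>" "1 \<le> M" "x \<le> n" "reaches_down M n \<pi> r x"
  shows "\<exists>y\<le>n. origin M \<pi> y = origin M \<pi> x \<and> depth M \<pi> y = depth M \<pi> x + r"
  using assms(3,4)
proof (induction r arbitrary: x)
  case (Suc r)
  then obtain c where c: "M < c" "c \<le> n" "\<pi> c = x" "reaches_down M n \<pi> r c"
    unfolding reaches_down.simps by (auto simp: Suc_le_eq)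
  from Suc.IH[OF c(2,4)] show ?case
    using origin_depth_parent[OF assms(1) c(1,2) assms(2)] c(3) by auto
qed auto

lemma deep_imp_reaches_down:
  assumes "recursive n \<pi>" "1 \<le> M" "1 \<le> y" "y \<le> n" "depth M \<pi> y = r + s"
  shows "\<exists>x. 1 \<le> x \<and> x \<le> n \<and> origin M \<pi> x = origin M \<pi> y \<and> depth M \<pi> x = s \<and>
    reaches_down M n \<pi> r x"
  using assms(5)
proof (induction r arbitrary: s)
  case 0
  then show ?case
    using assms by auto
next
  case (Suc r)
  from Suc.IH[of "Suc s"] Suc.prems obtain x where
    x: "1 \<le> x" "x \<le> n" "origin M \<pi> x = origin M \<pi> y" "depth M \<pi> x = Suc s"
      "reaches_down M n \<pi> r x"
    by auto
  have "M < x"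
    using x(4) by (subst (asm) depth.simps) (auto split: if_splits)
  note p = recursive_parent[OF assms(1) this x(2) assms(2)]
    origin_depth_parent[OF assms(1) this x(2) assms(2)]
  show ?case
    using p x \<open>M < x\<close> by (intro exI[of _ "\<pi> x"]) auto
qed

definition shallow :: "nat \<Rightarrow> nat \<Rightarrow> nat \<Rightarrow> (nat \<Rightarrow> nat) \<Rightarrow> nat \<Rightarrow> bool" where
  "shallow M m n \<pi> v \<longleftrightarrow> (\<forall>y\<in>{1..n}. origin M \<pi> y = v \<longrightarrow> depth M \<pi> y < m)"

lemma depth_eq_0_iff:
  assumes "recursive n \<pi>" "x \<le> n" "1 \<le> M"
  shows "depth M \<pi> x = 0 \<longleftrightarrow> x \<le> M"
proof (cases "x \<le> M")
  case True
  then show ?thesis by (subst depth.simps) simp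
next
  case False
  then show ?thesis using origin_depth_parent[OF assms(1) _ assms(2,3)] by simp
qed

lemma origin_id: "x \<le> M \<Longrightarrow> origin M \<pi> x = x"
  by (subst origin.simps) simp

lemma depth_0: "x \<le> M \<Longrightarrow> depth M \<pi> x = 0"
  by (subst depth.simps) simp

lemma shallow_iff:
  assumes "recursive n \<pi>" "v \<in> {1..M}" "M \<le> n"
  shows "shallow M m n \<pi> v \<longleftrightarrow> \<not> reaches_down M n \<pi> m v"
proof
  assume sh: "shallow M m n \<pi> v"
  show "\<not> reaches_down M n \<pi> m v"
  proof
    assume "reaches_down M n \<pi> m v"
    with assms obtain y where y: "y \<le> n" "origin M \<pi> y = origin M \<pi> v"
        "depth M \<pi> y = depth M \<pi> v + m"
      using reaches_down_imp_deep[of n \<pi> M v m] by auto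
    then have "y \<noteq> 0"
      using assms(2) origin_id[of 0 M \<pi>] origin_id[of v M \<pi>] by (cases y) auto
    with y sh assms(2) show False
      by (auto simp: shallow_def origin_id depth_0)
  qed
next
  assume nr: "\<not> reaches_down M n \<pi> m v"
  show "shallow M m n \<pi> v"
    unfolding shallow_def
  proof (intro ballI impI, rule ccontr)
    fix y assume y: "y \<in> {1..n}" "origin M \<pi> y = v" "\<not> depth M \<pi> y < m"
    then obtain s where "depth M \<pi> y = s + m"
      by (metis add.commute le_Suc_ex linorder_not_less)
    then have "depth M \<pi> y = (s + m) + 0"
      by simp
    then obtain x where x: "1 \<le> x" "x \<le> n" "origin M \<pi> x = v" "depth M \<pi> x = 0"
        "reaches_down M n \<pi> (s + m) x"
      using deep_imp_reaches_down[OF assms(1), of M y "s + m" 0] y assms(2) by auto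
    then have "x = v"
      using depth_eq_0_iff[OF assms(1) x(2), of M] assms(2) by (auto simp: origin_id)
    moreover have "reaches_down M n \<pi> m z" if "reaches_down M n \<pi> (s + m) z" for z
      using that by (induction s) (auto dest: reaches_down_SucD simp del: reaches_down.simps)
    ultimately show False
      using x(5) nr by blast
  qed
qed

section \<open>Which vertices survive the stripping\<close>

lemma tree_of_wf:
  assumes "recursive n \<pi>" "e \<in> snd (tree_of n \<pi>)"
  shows "e \<subseteq> fst (tree_of n \<pi>)"
proof -
  obtain i where "i \<in> {2..n}" "e = {i, \<pi> i}"
    using assms(2) by (auto simp: tree_of_def)
  moreover from this have "1 \<le> \<pi> i" "\<pi> i < i"
    using assms(1) by (auto simp: recursive_def)
  ultimately show ?thesis
    by (simp add: tree_of_def)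
qed

lemma finite_tree_of: "finite (snd (tree_of n \<pi>))"
  by (simp add: tree_of_def)

lemma tree_of_edge: "i \<in> {2..n} \<Longrightarrow> {i, \<pi> i} \<in> snd (tree_of n \<pi>)"
  by (auto simp: tree_of_def)

text \<open>
  The vertex set of a path from \<open>u\<close> to \<open>v\<close>, reduced to what the survival rule needs: a neighbour
  inside the set for the two ends, and two neighbours for every other vertex.
\<close>

definition path_vertices :: "ugraph \<Rightarrow> nat \<Rightarrow> nat \<Rightarrow> nat set \<Rightarrow> bool" where
  "path_vertices G u v P \<longleftrightarrow> u \<in> P \<and> v \<in> P \<and>
    (\<exists>a\<in>P. {u, a} \<in> snd G) \<and> (\<exists>a\<in>P. {v, a} \<in> snd G) \<and>
    (\<forall>x\<in>P - {u, v}. \<exists>a\<in>P. \<exists>b\<in>P. a \<noteq> b \<and> {x, a} \<in> snd G \<and> {x, b} \<in> snd G)"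

lemma path_vertices_sym: "path_vertices G u v P \<longleftrightarrow> path_vertices G v u P"
  unfolding path_vertices_def by (simp only: insert_commute conj_ac)

lemma path_vertices_Cons:
  assumes P: "path_vertices G p v P" and "{u, p} \<in> snd G" "u \<notin> P"
  shows "path_vertices G u v (insert u P)"
proof -
  have ends: "p \<in> P" "v \<in> P" "\<exists>a\<in>P. {p, a} \<in> snd G" "\<exists>a\<in>P. {v, a} \<in> snd G"
    and inner: "\<And>x. x \<in> P - {p, v} \<Longrightarrow> \<exists>a\<in>P. \<exists>b\<in>P. a \<noteq> b \<and> {x, a} \<in> snd G \<and> {x, b} \<in> snd G"
    using P unfolding path_vertices_def by simp_all
  have "\<exists>a\<in>insert u P. \<exists>b\<in>insert u P. a \<noteq> b \<and> {x, a} \<in> snd G \<and> {x, b} \<in> snd G"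
    if x: "x \<in> insert u P - {u, v}" for x
  proof (cases "x = p")
    case True
    then obtain a where a: "a \<in> P" "{x, a} \<in> snd G"
      using ends(3) by auto
    have "{x, u} \<in> snd G"
      using assms(2) True by (simp add: insert_commute)
    with a show ?thesis
      using \<open>u \<notin> P\<close> by (intro bexI[of _ u] bexI[of _ a]) auto
  next
    case False
    then obtain a b where "a \<in> P" "b \<in> P" "a \<noteq> b" "{x, a} \<in> snd G" "{x, b} \<in> snd G"
      using inner[of x] x by auto
    then show ?thesis
      by (intro bexI[of _ a] bexI[of _ b]) auto
  qed
  then show ?thesis
    using ends assms(2) unfolding path_vertices_def by auto
qed

text \<open>
  Induction on the number of vertices present. A newly added vertex is joined to an older one
  by prepending it to a path that starts from its parent. The new vertex cannot lie on that path, so no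
  backtracking arises.
\<close>

lemma tree_of_connected:
  assumes "recursive n \<pi>" "u \<noteq> v" "u \<in> {1..w}" "v \<in> {1..w}" "w \<le> n"
  shows "\<exists>P \<subseteq> {1..w}. path_vertices (tree_of n \<pi>) u v P"
  using assms(2-)
proof (induction w arbitrary: u v)
  case (Suc w)
  let ?G = "tree_of n \<pi>"
  have new: "\<exists>P \<subseteq> {1..Suc w}. path_vertices ?G (Suc w) v P" if v: "v \<in> {1..w}" for v
  proof -
    have p: "1 \<le> \<pi> (Suc w)" "\<pi> (Suc w) < Suc w"
      using assms(1) v Suc.prems by (auto simp: recursive_def)
    have edge: "{Suc w, \<pi> (Suc w)} \<in> snd ?G"
      using v Suc.prems by (intro tree_of_edge) auto
    show ?thesis
    proof (cases "\<pi> (Suc w) = v")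
      case True
      then show ?thesis
        using edge v insert_commute[of v "Suc w" "{}"]
        by (intro exI[of _ "{Suc w, v}"]) (simp add: path_vertices_def)
    next
      case False
      then obtain P where P: "P \<subseteq> {1..w}" "path_vertices ?G (\<pi> (Suc w)) v P"
        using Suc.IH[of "\<pi> (Suc w)" v] p v Suc.prems by auto
      then have "path_vertices ?G (Suc w) v (insert (Suc w) P)"
        by (intro path_vertices_Cons[OF P(2) edge]) fastforce
      then show ?thesis
        using P(1) by (intro exI[of _ "insert (Suc w) P"]) auto
    qed
  qed
  consider "u = Suc w" "v \<in> {1..w}" | "v = Suc w" "u \<in> {1..w}" | "u \<in> {1..w}" "v \<in> {1..w}"
    using Suc.prems by force
  then show ?case
  proof cases
    case 1
    then show ?thesis using new by blast
  next
    case 2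
    then obtain P where "P \<subseteq> {1..Suc w}" "path_vertices ?G v u P"
      using new[of u] by auto
    then show ?thesis
      using path_vertices_sym[of ?G u v P] by blast
  next
    case 3
    then obtain P where "P \<subseteq> {1..w}" "path_vertices ?G u v P"
      using Suc.IH[of u v] Suc.prems by auto
    then show ?thesis
      by (intro exI[of _ P]) auto
  qed
qed simp

text \<open>
  Join a descending chain of length \<open>m\<close> below \<open>u\<close>, the path from \<open>u\<close> to \<open>v\<close>, and a chain of length \<open>m\<close>
  below \<open>v\<close>. Each round removes at most the two ends of this long path. The invariant after \<open>i\<close> rounds is
  that the part of the path within \<open>{1..M}\<close> is intact and that the vertices of the two subtrees
  with a descending chain of length \<open>i\<close> are still present.
\<close>

lemma two_deep_survive:
  assumes rec: "recursive n \<pi>" and "M \<le> n" and uv: "u \<in> {1..M}" "v \<in> {1..M}" "u \<noteq> v"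
    and deep: "reaches_down M n \<pi> m u" "reaches_down M n \<pi> m v"
  shows "u \<in> fst ((strip_leaves ^^ m) (tree_of n \<pi>))"
proof -
  define G where "G = tree_of n \<pi>"
  define V where "V i = fst ((strip_leaves ^^ i) G)" for i
  have survive: "x \<in> V (Suc i)"
    if "x \<in> V i" "a \<in> V i" "{x, a} \<in> snd G" "b \<in> V i" "{x, b} \<in> snd G" "a \<noteq> b" for x i a b
    using survives_round[OF tree_of_wf[OF rec] finite_tree_of] that unfolding V_def G_def by blast
  have edge: "{x, \<pi> x} \<in> snd G" "{\<pi> x, x} \<in> snd G" if "M < x" "x \<le> n" for x
    using tree_of_edge[of x n \<pi>] that uv by (simp_all add: G_def insert_commute)
  obtain P where PM: "P \<subseteq> {1..M}" and "path_vertices G u v P"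
    using tree_of_connected[OF rec \<open>u \<noteq> v\<close> uv(1,2) \<open>M \<le> n\<close>] unfolding G_def by blast
  then have P: "u \<in> P" "v \<in> P" "\<exists>a\<in>P. {u, a} \<in> snd G" "\<exists>a\<in>P. {v, a} \<in> snd G"
    "\<forall>x\<in>P - {u, v}. \<exists>a\<in>P. \<exists>b\<in>P. a \<noteq> b \<and> {x, a} \<in> snd G \<and> {x, b} \<in> snd G"
    unfolding path_vertices_def by blast+
  have deep_le: "reaches_down M n \<pi> i w" if "i \<le> m" "w \<in> {u, v}" for i w
    using that(1)
  proof (induction rule: inc_induct)
    case base
    then show ?case
      using deep that(2) by blast
  next
    case (step k)
    then show ?case
      by (blast dest: reaches_down_SucD)
  qed
  have "P \<subseteq> V i \<and> (\<forall>x\<in>{Suc M..n}. origin M \<pi> x \<in> {u, v} \<longrightarrow> reaches_down M n \<pi> i x \<longrightarrow> x \<in> V i)"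
    if "i \<le> m" for i
    using that
  proof (induction i)
    case 0
    have "V 0 = {1..n}"
      by (simp add: V_def G_def tree_of_def)
    then show ?case
      using PM \<open>M \<le> n\<close> by auto
  next
    case (Suc i)
    have IH: "P \<subseteq> V i" "\<And>x. \<lbrakk>M < x; x \<le> n; origin M \<pi> x \<in> {u, v};
        reaches_down M n \<pi> i x\<rbrakk> \<Longrightarrow> x \<in> V i"
      using Suc.IH Suc.prems by (auto simp: Suc_le_eq)
    have child: "\<exists>c. M < c \<and> c \<le> n \<and> \<pi> c = w \<and> c \<in> V i"
      if down: "reaches_down M n \<pi> (Suc i) w" and "origin M \<pi> w \<in> {u, v}" for w
    proof -
      from down obtain c where c: "M < c" "c \<le> n" "\<pi> c = w" "reaches_down M n \<pi> i c"
        unfolding reaches_down.simps by (auto simp: Suc_le_eq)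
      moreover have "origin M \<pi> c = origin M \<pi> w"
        using origin_depth_parent[OF rec c(1,2)] c(3) uv by simp
      ultimately show ?thesis
        using IH(2)[of c] that(2) by metis
    qed
    have "x \<in> V (Suc i)" if x: "x \<in> P" for x
    proof (cases "x \<in> {u, v}")
      case True
      then have "origin M \<pi> x \<in> {u, v}"
        using uv by (auto simp: origin_id)
      from child[OF deep_le[OF Suc.prems True] this]
      obtain c where c: "M < c" "c \<le> n" "\<pi> c = x" "c \<in> V i"
        by blast
      from True P(3,4) obtain a where a: "a \<in> P" "{x, a} \<in> snd G"
        by blast
      have "a \<noteq> c" "{x, c} \<in> snd G"
        using a PM c edge(2)[of c] by auto
      then show ?thesis
        using IH(1) a c x by (intro survive[of x i a c]) auto
    next
      case False
      then obtain a b where "a \<in> P" "b \<in> P" "a \<noteq> b" "{x, a} \<in> snd G" "{x, b} \<in> snd G"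
        using P(5) x by blast
      then show ?thesis
        using IH(1) x by (intro survive[of x i a b]) auto
    qed
    moreover have "x \<in> V (Suc i)"
      if x: "M < x" "x \<le> n" "origin M \<pi> x \<in> {u, v}" "reaches_down M n \<pi> (Suc i) x" for x
    proof -
      have "x \<in> V i"
        using IH(2)[OF x(1-3) reaches_down_SucD[OF x(4)]] .
      from child[OF x(4,3)] obtain c where c: "M < c" "c \<le> n" "\<pi> c = x" "c \<in> V i"
        by blast
      have "1 \<le> M"
        using uv by simp
      note p = recursive_parent[OF rec x(1,2) \<open>1 \<le> M\<close>] origin_depth_parent[OF rec x(1,2) \<open>1 \<le> M\<close>]
      have "x < c"
        using recursive_parent[OF rec c(1,2) \<open>1 \<le> M\<close>] c(3) by simp
      have "\<pi> x \<in> V i"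
      proof (cases "\<pi> x \<le> M")
        case True
        then have "\<pi> x \<in> {u, v}"
          using p x(3) by (simp add: origin_id)
        then show ?thesis
          using P(1,2) IH(1) by blast
      next
        case False
        have "reaches_down M n \<pi> (Suc i) (\<pi> x)"
          unfolding reaches_down.simps(2)
          using x(1,2) reaches_down_SucD[OF x(4)] by (intro bexI[of _ x]) auto
        then show ?thesis
          using IH(2)[OF _ _ _ reaches_down_SucD, of "\<pi> x"] False p x(2,3) by simp
      qed
      then show ?thesis
        using \<open>x \<in> V i\<close> c p \<open>x < c\<close> edge(1)[OF x(1,2)] edge(2)[OF c(1,2)]
        by (intro survive[of x i "\<pi> x" c]) auto
    qed
    ultimately show ?case
      by (auto simp: Suc_le_eq simp del: reaches_down.simps)
  qed
  from this[of m] show ?thesis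
    using P(1) by (auto simp: V_def G_def)
qed

text \<open>
  Stripping eats a subtree from below: a vertex of the subtree at \<open>1\<close> with no descending chain of
  length \<open>i\<close> is gone after \<open>i\<close> rounds, since all its children left one round earlier and only
  one further edge is available. For the vertices beyond \<open>M\<close> that edge leads to the parent; for the root
  it is the edge to vertex \<open>2\<close>, the only neighbour of \<open>1\<close> among the first \<open>M\<close> vertices.
\<close>

lemma root_stripped:
  assumes rec: "recursive n \<pi>" and M: "2 \<le> M" "M \<le> n"
    and leaf: "\<forall>i\<in>{3..M}. \<pi> i \<noteq> 1"
    and "\<not> reaches_down M n \<pi> m 1"
  shows "1 \<notin> fst ((strip_leaves ^^ m) (tree_of n \<pi>))"
proof -
  let ?G = "tree_of n \<pi>"
  let ?V = "\<lambda>i. fst ((strip_leaves ^^ i) ?G)"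
  have "x \<notin> ?V i" if "\<not> reaches_down M n \<pi> i x" "x = 1 \<or> x \<in> {Suc M..n}" for i x
    using that
  proof (induction i arbitrary: x)
    case (Suc i)
    \<comment> \<open>The only edge at \<open>x\<close> that can outlive the children of \<open>x\<close>.\<close>
    define e0 where "e0 = (if x = 1 then {2, 1} else {x, \<pi> x})"
    have "e = e0" if e: "e \<in> snd ?G" "x \<in> e" "e \<subseteq> ?V i" for e
    proof -
      from e(1) obtain c where c: "c \<in> {2..n}" "e = {c, \<pi> c}"
        by (auto simp: tree_of_def)
      show ?thesis
      proof (cases "c = x")
        case True
        then show ?thesis
          using c by (auto simp: e0_def)
      next
        case False
        then have cx: "\<pi> c = x"
          using c e(2) by auto
        show ?thesis
        proof (cases "c \<le> M")
          case True
          have "\<pi> c < c"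
            using rec c by (auto simp: recursive_def)
          then have "x = 1"
            using cx True Suc.prems by auto
          then have "c = 2"
            using leaf cx c True by (cases "c = 2") auto
          then show ?thesis
            using c cx \<open>x = 1\<close> by (auto simp: e0_def)
        next
          case False
          then have "\<not> reaches_down M n \<pi> i c"
            using Suc.prems(1) cx c by auto
          from Suc.IH[OF this] False c have "c \<notin> ?V i"
            by auto
          then show ?thesis
            using e(3) c by auto
        qed
      qed
    qed
    then show ?case
      by (rule removed_by_round[OF tree_of_wf[OF rec], rotated])
  qed simp
  then show ?thesis
    using assms(5) by blast
qed

text \<open>
  Selecting one deep vertex from each pair \<open>v\<close>, \<open>v + K\<close> yields \<open>K \<ge> 2\<close> deep vertices, and any two of
  them let each other survive.
\<close>

lemma many_survive_unless_pair_shallow: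
  assumes rec: "recursive n \<pi>" and K: "2 \<le> K" "2 * K \<le> n"
    and deep: "\<forall>v\<in>{1..K}. \<not> (shallow (2 * K) m n \<pi> v \<and> shallow (2 * K) m n \<pi> (v + K))"
  shows "K \<le> card (fst ((strip_leaves ^^ m) (tree_of n \<pi>)))"
proof -
  let ?V = "fst ((strip_leaves ^^ m) (tree_of n \<pi>))"
  define f where "f v = (if shallow (2 * K) m n \<pi> v then v + K else v)" for v
  have inj: "inj_on f {1..K}"
    by (auto simp: inj_on_def f_def split: if_splits)
  have f_deep: "f v \<in> {1..2 * K}" "reaches_down (2 * K) n \<pi> m (f v)" if "v \<in> {1..K}" for v
  proof -
    show range: "f v \<in> {1..2 * K}"
      using that by (auto simp: f_def)
    show "reaches_down (2 * K) n \<pi> m (f v)"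
      using shallow_iff[OF rec range K(2), of m] deep that by (auto simp: f_def split: if_splits)
  qed
  have "f v \<in> ?V" if v: "v \<in> {1..K}" for v
  proof -
    obtain w where w: "w \<in> {1..K}" "w \<noteq> v"
    proof (cases "v = 1")
      case True
      then show ?thesis using that[of 2] K by auto
    next
      case False
      then show ?thesis using that[of 1] K by auto
    qed
    then have "f v \<noteq> f w"
      using inj v by (auto dest: inj_onD)
    then show ?thesis
      using two_deep_survive[OF rec K(2)] f_deep v w by blast
  qed
  then have "f ` {1..K} \<subseteq> ?V"
    by blast
  moreover have "finite ?V"
    by (rule finite_subset[of _ "{1..n}"], rule strip_leaves_power_subset[of m "tree_of n \<pi>", THEN order_trans])
       (simp_all add: tree_of_def)
  ultimately have "card (f ` {1..K}) \<le> card ?V"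
    by (intro card_mono)
  then show ?thesis
    using inj by (simp add: card_image)
qed

section \<open>Urn dynamics of a single subtree\<close>

text \<open>
  The height of a subtree depends on its growth only through the multiset of the depths of its
  vertices: among \<open>x\<close> vertices in all, each vertex of the subtree is the next parent with probability
  \<open>1 / x\<close>, and a parent at depth \<open>d\<close> adds a vertex at depth \<open>d + 1\<close>. The value
  \<open>shallow_prob m t x A\<close> is the probability that, starting from the depths \<open>A\<close> among \<open>x\<close>
  vertices, all depths are still below \<open>m\<close> after \<open>t\<close> further steps. As the recursion involves neither the
  other subtrees nor the root, it shows at once that the subtrees are exchangeable.
\<close>

fun shallow_prob :: "nat \<Rightarrow> nat \<Rightarrow> nat \<Rightarrow> nat multiset \<Rightarrow> real" where
  "shallow_prob m 0 x A = of_bool (\<forall>d\<in>#A. d < m)"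
| "shallow_prob m (Suc t) x A =
     ((\<Sum>d\<in>#A. shallow_prob m t (Suc x) (add_mset (Suc d) A)) +
      (real x - real (size A)) * shallow_prob m t (Suc x) A) / real x"

text \<open>
  An additional vertex can only make a subtree deeper: in the average defining the left-hand side, it
  turns one of the outcomes that leave the subtree unchanged into one that enlarges it.
  The bound \<open>size A < x\<close> provides a vertex outside the subtree for this exchange and keeps the weight
  of the remaining ones nonnegative.
\<close>

lemma shallow_prob_add_mset_le:
  "size A < x \<Longrightarrow> shallow_prob m t x (add_mset e A) \<le> shallow_prob m t x A"
proof (induction t arbitrary: x A e)
  case (Suc t)
  let ?F = "shallow_prob m t (Suc x)"
  have "(\<Sum>d\<in>#A. ?F (add_mset (Suc d) (add_mset e A))) \<le> (\<Sum>d\<in>#A. ?F (add_mset (Suc d) A))"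
  proof (rule sum_mset_mono)
    fix d
    show "?F (add_mset (Suc d) (add_mset e A)) \<le> ?F (add_mset (Suc d) A)"
      using Suc.IH[of "add_mset (Suc d) A" "Suc x" e] Suc.prems by (simp add: add_mset_commute)
  qed
  moreover have "?F (add_mset (Suc e) (add_mset e A)) \<le> ?F (add_mset e A)"
    using Suc.IH[of "add_mset e A" "Suc x" "Suc e"] Suc.prems by simp
  moreover have "(real x - real (size A)) * ?F (add_mset e A) \<le> (real x - real (size A)) * ?F A"
    using Suc.IH[of A "Suc x" e] Suc.prems by (intro mult_left_mono) auto
  ultimately have "(\<Sum>d\<in>#add_mset e A. ?F (add_mset (Suc d) (add_mset e A))) +
      (real x - real (size (add_mset e A))) * ?F (add_mset e A)
      \<le> (\<Sum>d\<in>#A. ?F (add_mset (Suc d) A)) + (real x - real (size A)) * ?F A"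
    by (simp add: algebra_simps)
  then show ?case
    unfolding shallow_prob.simps by (rule divide_right_mono) simp
qed auto

definition profile :: "nat \<Rightarrow> (nat \<Rightarrow> nat) \<Rightarrow> nat \<Rightarrow> nat \<Rightarrow> nat multiset" where
  "profile M \<pi> v x = image_mset (depth M \<pi>) (mset_set {y \<in> {1..x}. origin M \<pi> y = v})"

lemma size_profile_le: "size (profile M \<pi> v x) \<le> x"
proof -
  have "card {y \<in> {1..x}. origin M \<pi> y = v} \<le> card {1..x}"
    by (rule card_mono) auto
  then show ?thesis
    by (simp add: profile_def)
qed

lemma profile_Suc:
  assumes "M \<le> x" "p \<in> {1..x}"
  shows "profile M (\<pi>(Suc x := p)) v (Suc x) =
    (if origin M \<pi> p = v then add_mset (Suc (depth M \<pi> p)) (profile M \<pi> v x) else profile M \<pi> v x)"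
proof -
  let ?\<pi> = "\<pi>(Suc x := p)"
  let ?S = "{y \<in> {1..x}. origin M \<pi> y = v}"
  have new: "origin M ?\<pi> (Suc x) = origin M \<pi> p" "depth M ?\<pi> (Suc x) = Suc (depth M \<pi> p)"
    using assms origin.simps[of M ?\<pi> "Suc x"] depth.simps[of M ?\<pi> "Suc x"]
    by (simp_all add: origin_fun_upd depth_fun_upd)
  have "{y \<in> {1..Suc x}. origin M ?\<pi> y = v} = (if origin M \<pi> p = v then insert (Suc x) ?S else ?S)"
    using new(1) by (auto simp: origin_fun_upd le_Suc_eq)
  moreover have "image_mset (depth M ?\<pi>) (mset_set ?S) = image_mset (depth M \<pi>) (mset_set ?S)"
    by (rule image_mset_cong) (simp add: depth_fun_upd)
  ultimately show ?thesis
    by (simp add: profile_def new(2))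
qed

lemma profile_start: "v \<in> {1..M} \<Longrightarrow> profile M \<pi> v M = {#0#}"
proof -
  assume "v \<in> {1..M}"
  then have "{y \<in> {1..M}. origin M \<pi> y = v} = {v}"
    by (auto simp: origin_id)
  then show ?thesis
    using \<open>v \<in> {1..M}\<close> by (simp add: profile_def depth_0)
qed

lemma shallow_prob_0_profile:
  "shallow_prob m 0 n (profile M \<pi> v n) = of_bool (shallow M m n \<pi> v)"
  by (auto simp: profile_def shallow_def)

text \<open>
  The conditional probability of being shallow, given the tree so far, is a martingale.
\<close>

lemma shallow_prob_step:
  assumes "M \<le> x"
  shows "(\<Sum>p\<in>{1..x}. shallow_prob m t (Suc x) (profile M (\<pi>(Suc x := p)) v (Suc x))) / real x =
    shallow_prob m (Suc t) x (profile M \<pi> v x)"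
proof -
  let ?A = "profile M \<pi> v x" and ?F = "shallow_prob m t (Suc x)"
  let ?S = "{y \<in> {1..x}. origin M \<pi> y = v}"
  have "(\<Sum>p\<in>{1..x}. ?F (profile M (\<pi>(Suc x := p)) v (Suc x))) =
      (\<Sum>p\<in>{1..x}. if origin M \<pi> p = v then ?F (add_mset (Suc (depth M \<pi> p)) ?A) else ?F ?A)"
    using assms by (intro sum.cong refl) (simp add: profile_Suc)
  also have "\<dots> = (\<Sum>p\<in>?S. ?F (add_mset (Suc (depth M \<pi> p)) ?A)) +
      real (card ({1..x} - ?S)) * ?F ?A"
    by (subst sum.If_cases) (auto intro!: arg_cong2[of _ _ _ _ "(+)"] arg_cong2[of _ _ _ _ "(*)"]
          arg_cong[of _ _ card] arg_cong[of _ _ "sum _"])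
  also have "real (card ({1..x} - ?S)) = real x - real (card ?S)"
  proof -
    have "card ({1..x} - ?S) = card {1..x} - card ?S" "card ?S \<le> card {1..x}"
      by (intro card_Diff_subset card_mono; auto)+
    then show ?thesis
      by simp
  qed
  finally have "(\<Sum>p\<in>{1..x}. ?F (profile M (\<pi>(Suc x := p)) v (Suc x))) =
      (\<Sum>p\<in>?S. ?F (add_mset (Suc (depth M \<pi> p)) ?A)) + (real x - real (card ?S)) * ?F ?A" .
  moreover have "(\<Sum>p\<in>?S. ?F (add_mset (Suc (depth M \<pi> p)) ?A)) = (\<Sum>d\<in>#?A. ?F (add_mset (Suc d) ?A))"
    unfolding sum_unfold_sum_mset
    by (rule arg_cong[of _ _ sum_mset])
       (simp add: profile_def[of M \<pi> v x] multiset.map_comp o_def del: of_nat_Suc)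
  moreover have "size ?A = card ?S"
    by (simp add: profile_def)
  ultimately show ?thesis
    by (simp only: shallow_prob.simps)
qed

section \<open>Laws of the subtree depths\<close>

text \<open>
  Here \<open>h\<close> stands for any quantity determined by the tree on the first \<open>M\<close> vertices.
\<close>

lemma expectation_shallow_prob:
  assumes "1 \<le> M" "M \<le> x" and h: "\<And>\<pi> y p. M < y \<Longrightarrow> h (\<pi>(y := p)) = h \<pi>"
  shows "measure_pmf.expectation (random_parents (x + t))
      (\<lambda>\<pi>. h \<pi> * shallow_prob m 0 (x + t) (profile M \<pi> v (x + t))) =
    measure_pmf.expectation (random_parents x) (\<lambda>\<pi>. h \<pi> * shallow_prob m t x (profile M \<pi> v x))"
  using assms(2)
proof (induction t arbitrary: x)
  case (Suc t)
  let ?F = "shallow_prob m t (Suc x)"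
  have "measure_pmf.expectation (random_parents (x + Suc t))
      (\<lambda>\<pi>. h \<pi> * shallow_prob m 0 (x + Suc t) (profile M \<pi> v (x + Suc t))) =
    measure_pmf.expectation (random_parents (Suc x)) (\<lambda>\<pi>. h \<pi> * ?F (profile M \<pi> v (Suc x)))"
    using Suc.IH[of "Suc x"] Suc.prems by simp
  also have "\<dots> = measure_pmf.expectation (random_parents x)
      (\<lambda>\<pi>. (\<Sum>p\<in>{1..x}. h (\<pi>(Suc x := p)) * ?F (profile M (\<pi>(Suc x := p)) v (Suc x))) / real x)"
    using assms(1) Suc.prems by (intro expectation_random_parents_Suc) simp
  also have "\<dots> = measure_pmf.expectation (random_parents x)
      (\<lambda>\<pi>. h \<pi> * shallow_prob m (Suc t) x (profile M \<pi> v x))"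
    using Suc.prems by (simp only: h less_Suc_eq_le sum_distrib_left[symmetric] times_divide_eq_right[symmetric]
        shallow_prob_step)
  finally show ?case .
qed simp

text \<open>
  The source of the negative correlation. One new vertex can enlarge at most one of two given subtrees,
  so at most one of the two conditional probabilities drops below its value \<open>a\<close> or \<open>b\<close>
  for an unchanged subtree. With \<open>x\<close> and \<open>y\<close> the two averages, the average of the products
  falls short of \<open>x * y\<close> by exactly \<open>(a - x) * (b - y)\<close>.
\<close>

lemma average_mult_le:
  fixes \<alpha> \<beta> :: "'a \<Rightarrow> real"
  assumes "finite I" "I \<noteq> {}" and le: "\<And>i. i \<in> I \<Longrightarrow> \<alpha> i \<le> a" "\<And>i. i \<in> I \<Longrightarrow> \<beta> i \<le> b"
    and one: "\<And>i. i \<in> I \<Longrightarrow> \<alpha> i = a \<or> \<beta> i = b"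
  shows "(\<Sum>i\<in>I. \<alpha> i * \<beta> i) / card I \<le> (\<Sum>i\<in>I. \<alpha> i) / card I * ((\<Sum>i\<in>I. \<beta> i) / card I)"
proof -
  define x y where "x = (\<Sum>i\<in>I. \<alpha> i) / card I" and "y = (\<Sum>i\<in>I. \<beta> i) / card I"
  have c: "real (card I) > 0"
    using assms(1,2) by (simp add: card_gt_0_iff)
  have "(\<Sum>i\<in>I. \<alpha> i) \<le> card I * a" "(\<Sum>i\<in>I. \<beta> i) \<le> card I * b"
    using sum_bounded_above[of I \<alpha> a] sum_bounded_above[of I \<beta> b] le by auto
  then have "x \<le> a" "y \<le> b"
    using c by (simp_all add: x_def y_def divide_le_eq mult.commute)
  \<comment> \<open>Termwise this says \<open>(a - \<alpha> i) * (b - \<beta> i) = 0\<close>.\<close>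
  have "(\<Sum>i\<in>I. \<alpha> i * \<beta> i) = (\<Sum>i\<in>I. a * \<beta> i + b * \<alpha> i - a * b)"
    using one by (intro sum.cong refl) (fastforce simp: algebra_simps)
  also have "\<dots> = a * (\<Sum>i\<in>I. \<beta> i) + b * (\<Sum>i\<in>I. \<alpha> i) - card I * (a * b)"
    by (simp add: sum.distrib sum_subtractf sum_distrib_left)
  finally have "(\<Sum>i\<in>I. \<alpha> i * \<beta> i) / card I = a * y + b * x - a * b"
    using c by (simp add: x_def y_def add_divide_distrib diff_divide_distrib)
  also have "\<dots> = x * y - (a - x) * (b - y)"
    by (simp add: algebra_simps)
  also have "\<dots> \<le> x * y"
    using \<open>x \<le> a\<close> \<open>y \<le> b\<close> by simp
  finally show ?thesis
    by (simp add: x_def y_def)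
qed

lemma shallow_prob_pair_step:
  assumes "1 \<le> M" "M \<le> x" "u \<noteq> v"
  shows "(\<Sum>p\<in>{1..x}. shallow_prob m t (Suc x) (profile M (\<pi>(Suc x := p)) u (Suc x)) *
      shallow_prob m t (Suc x) (profile M (\<pi>(Suc x := p)) v (Suc x))) / real x
    \<le> shallow_prob m (Suc t) x (profile M \<pi> u x) * shallow_prob m (Suc t) x (profile M \<pi> v x)"
proof -
  let ?F = "\<lambda>p w. shallow_prob m t (Suc x) (profile M (\<pi>(Suc x := p)) w (Suc x))"
  let ?c = "\<lambda>w. shallow_prob m t (Suc x) (profile M \<pi> w x)"
  have le: "?F p w \<le> ?c w" if "p \<in> {1..x}" for p w
    using that assms(2) size_profile_le[of M \<pi> w x]
    by (auto simp: profile_Suc intro!: shallow_prob_add_mset_le)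
  have "(\<Sum>p\<in>{1..x}. ?F p u * ?F p v) / card {1..x} \<le>
      (\<Sum>p\<in>{1..x}. ?F p u) / card {1..x} * ((\<Sum>p\<in>{1..x}. ?F p v) / card {1..x})"
  proof (rule average_mult_le)
    fix p assume "p \<in> {1..x}"
    then show "?F p u = ?c u \<or> ?F p v = ?c v"
      using assms by (auto simp: profile_Suc)
  qed (use assms le in auto)
  then show ?thesis
    using assms(2) by (simp only: card_atLeastAtMost diff_Suc_1 shallow_prob_step)
qed

text \<open>
  The product of two of these martingales is a supermartingale.
\<close>

lemma expectation_shallow_prob_pair:
  assumes "1 \<le> M" "M \<le> x" "u \<noteq> v"
  shows "measure_pmf.expectation (random_parents (x + t))
      (\<lambda>\<pi>. shallow_prob m 0 (x + t) (profile M \<pi> u (x + t)) *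
            shallow_prob m 0 (x + t) (profile M \<pi> v (x + t))) \<le>
    measure_pmf.expectation (random_parents x)
      (\<lambda>\<pi>. shallow_prob m t x (profile M \<pi> u x) * shallow_prob m t x (profile M \<pi> v x))"
  using assms(2)
proof (induction t arbitrary: x)
  case (Suc t)
  let ?F = "\<lambda>\<pi> w. shallow_prob m t (Suc x) (profile M \<pi> w (Suc x))"
  have "measure_pmf.expectation (random_parents (x + Suc t))
      (\<lambda>\<pi>. shallow_prob m 0 (x + Suc t) (profile M \<pi> u (x + Suc t)) *
            shallow_prob m 0 (x + Suc t) (profile M \<pi> v (x + Suc t))) \<le>
    measure_pmf.expectation (random_parents (Suc x)) (\<lambda>\<pi>. ?F \<pi> u * ?F \<pi> v)"
    using Suc.IH[of "Suc x"] Suc.prems by simp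
  also have "\<dots> = measure_pmf.expectation (random_parents x)
      (\<lambda>\<pi>. (\<Sum>p\<in>{1..x}. ?F (\<pi>(Suc x := p)) u * ?F (\<pi>(Suc x := p)) v) / real x)"
    using assms(1) Suc.prems by (intro expectation_random_parents_Suc) simp
  also have "\<dots> \<le> measure_pmf.expectation (random_parents x)
      (\<lambda>\<pi>. shallow_prob m (Suc t) x (profile M \<pi> u x) * shallow_prob m (Suc t) x (profile M \<pi> v x))"
    using assms(1,3) Suc.prems by (intro expectation_random_parents_mono shallow_prob_pair_step)
  finally show ?case .
qed simp

lemma shallow_independent_of_start:
  assumes "v \<in> {1..M}" "M \<le> n" and h: "\<And>\<pi> y p. M < y \<Longrightarrow> h (\<pi>(y := p)) = h \<pi>"
  shows "measure_pmf.expectation (random_parents n) (\<lambda>\<pi>. h \<pi> * of_bool (shallow M m n \<pi> v)) =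
    measure_pmf.expectation (random_parents M) h * shallow_prob m (n - M) M {#0#}"
  using expectation_shallow_prob[of M M h "n - M" m v] assms
  by (simp add: shallow_prob_0_profile profile_start del: shallow_prob.simps)

lemma shallow_negatively_correlated:
  assumes "u \<in> {1..M}" "v \<in> {1..M}" "u \<noteq> v" "M \<le> n"
  shows "measure_pmf.expectation (random_parents n)
      (\<lambda>\<pi>. of_bool (shallow M m n \<pi> u) * of_bool (shallow M m n \<pi> v)) \<le>
    (shallow_prob m (n - M) M {#0#})\<^sup>2"
  using expectation_shallow_prob_pair[of M M u v "n - M" m] assms
  by (simp add: shallow_prob_0_profile profile_start power2_eq_square
        del: shallow_prob.simps of_bool_conj)

text \<open>
  Each vertex \<open>i\<close> from \<open>3\<close> on avoids the root with probability \<open>(i - 2) / (i - 1)\<close>, and the product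
  telescopes.
\<close>

lemma prob_root_is_leaf:
  assumes "2 \<le> M"
  shows "measure_pmf.expectation (random_parents M) (\<lambda>\<pi>. of_bool (\<forall>i\<in>{3..M}. \<pi> i \<noteq> 1)) =
    1 / (real M - 1)"
  using assms
proof (induction M rule: nat_induct_at_least)
  case (Suc M)
  let ?h = "\<lambda>\<pi> :: nat \<Rightarrow> nat. of_bool (\<forall>i\<in>{3..M}. \<pi> i \<noteq> 1) :: real"
  have "(\<Sum>p\<in>{1..M}. of_bool (\<forall>i\<in>{3..Suc M}. (\<pi>(Suc M := p)) i \<noteq> 1)) =
      ?h \<pi> * (real M - 1)" for \<pi> :: "nat \<Rightarrow> nat"
  proof -
    have "{3..Suc M} = insert (Suc M) {3..M}"
      using Suc.hyps by auto
    moreover have "(\<forall>i\<in>{3..M}. (\<pi>(Suc M := p)) i \<noteq> 1) \<longleftrightarrow> (\<forall>i\<in>{3..M}. \<pi> i \<noteq> 1)" for p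
      by (intro ball_cong) auto
    ultimately have "(\<Sum>p\<in>{1..M}. of_bool (\<forall>i\<in>{3..Suc M}. (\<pi>(Suc M := p)) i \<noteq> 1)) =
        (\<Sum>p\<in>{1..M}. ?h \<pi> * of_bool (p \<noteq> 1))"
      by (intro sum.cong refl) (simp del: fun_upd_apply add: fun_upd_same)
    also have "\<dots> = ?h \<pi> * (\<Sum>p\<in>{1..M}. of_bool (p \<noteq> 1))"
      by (simp only: sum_distrib_left)
    also have "(\<Sum>p\<in>{1..M}. of_bool (p \<noteq> 1) :: real) = (\<Sum>p\<in>{2..M}. 1)"
      by (intro sum.mono_neutral_cong_right) auto
    also have "\<dots> = real M - 1"
      using Suc.hyps by (simp add: of_nat_diff)
    finally show ?thesis .
  qed
  then have "measure_pmf.expectation (random_parents (Suc M))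
      (\<lambda>\<pi>. of_bool (\<forall>i\<in>{3..Suc M}. \<pi> i \<noteq> 1)) =
    measure_pmf.expectation (random_parents M) (\<lambda>\<pi>. ?h \<pi> * (real M - 1) / real M)"
    using Suc.hyps by (subst expectation_random_parents_Suc) simp_all
  also have "\<dots> = 1 / (real M - 1) * (real M - 1) / real M"
    using Suc.IH by simp
  finally show ?case
    using Suc.hyps by simp
qed simp

lemma shallow_prob_le:
  assumes "2 \<le> M" "M \<le> n"
  shows "shallow_prob m (n - M) M {#0#} \<le> (real M - 1) *
    measure_pmf.prob (random_parents n) {\<pi>. 1 \<notin> fst ((strip_leaves ^^ m) (tree_of n \<pi>))}"
proof -
  let ?h = "\<lambda>\<pi> :: nat \<Rightarrow> nat. of_bool (\<forall>i\<in>{3..M}. \<pi> i \<noteq> 1) :: real"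
  have "1 / (real M - 1) * shallow_prob m (n - M) M {#0#} =
      measure_pmf.expectation (random_parents n) (\<lambda>\<pi>. ?h \<pi> * of_bool (shallow M m n \<pi> 1))"
    using assms by (subst shallow_independent_of_start) (auto simp del: One_nat_def simp: prob_root_is_leaf)
  also have "\<dots> \<le> measure_pmf.expectation (random_parents n)
      (\<lambda>\<pi>. of_bool (1 \<notin> fst ((strip_leaves ^^ m) (tree_of n \<pi>))))"
  proof (rule expectation_random_parents_mono)
    fix \<pi> assume rec: "recursive n \<pi>"
    have "1 \<notin> fst ((strip_leaves ^^ m) (tree_of n \<pi>))"
      if "\<forall>i\<in>{3..M}. \<pi> i \<noteq> 1" "shallow M m n \<pi> 1"
      using root_stripped[OF rec assms that(1)] shallow_iff[OF rec, of 1 M m] that(2) assms by auto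
    then show "?h \<pi> * of_bool (shallow M m n \<pi> 1) \<le>
        of_bool (1 \<notin> fst ((strip_leaves ^^ m) (tree_of n \<pi>)))"
      by (auto simp: of_bool_def)
  qed
  finally show ?thesis
    using assms(1) by (simp add: prob_random_parents field_simps)
qed

lemma prob_few_survivors_le:
  assumes "2 \<le> K" "2 * K \<le> n"
  shows "measure_pmf.prob (random_parents n)
      {\<pi>. \<not> K \<le> card (fst ((strip_leaves ^^ m) (tree_of n \<pi>)))} \<le>
    real K * (shallow_prob m (n - 2 * K) (2 * K) {#0#})\<^sup>2"
proof -
  let ?s = "\<lambda>\<pi> v. of_bool (shallow (2 * K) m n \<pi> v) :: real"
  have "measure_pmf.prob (random_parents n)
      {\<pi>. \<not> K \<le> card (fst ((strip_leaves ^^ m) (tree_of n \<pi>)))} \<le>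
    measure_pmf.expectation (random_parents n) (\<lambda>\<pi>. \<Sum>v\<in>{1..K}. ?s \<pi> v * ?s \<pi> (v + K))"
    unfolding prob_random_parents
  proof (rule expectation_random_parents_mono)
    fix \<pi> assume rec: "recursive n \<pi>"
    have nonneg: "0 \<le> (\<Sum>v\<in>{1..K}. ?s \<pi> v * ?s \<pi> (v + K))"
      by (intro sum_nonneg) auto
    have "1 \<le> (\<Sum>v\<in>{1..K}. ?s \<pi> v * ?s \<pi> (v + K))"
      if "\<not> K \<le> card (fst ((strip_leaves ^^ m) (tree_of n \<pi>)))"
    proof -
      obtain v where v: "v \<in> {1..K}" "shallow (2 * K) m n \<pi> v" "shallow (2 * K) m n \<pi> (v + K)"
        using many_survive_unless_pair_shallow[OF rec assms] \<open>\<not> K \<le> _\<close> by blast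
      have "?s \<pi> v * ?s \<pi> (v + K) \<le> (\<Sum>v\<in>{1..K}. ?s \<pi> v * ?s \<pi> (v + K))"
        using v(1) by (intro member_le_sum) auto
      then show ?thesis
        using v by simp
    qed
    then show "of_bool (\<not> K \<le> card (fst ((strip_leaves ^^ m) (tree_of n \<pi>)))) \<le>
        (\<Sum>v\<in>{1..K}. ?s \<pi> v * ?s \<pi> (v + K))"
      using nonneg by (cases "K \<le> card (fst ((strip_leaves ^^ m) (tree_of n \<pi>)))") auto
  qed
  also have "\<dots> = (\<Sum>v\<in>{1..K}. measure_pmf.expectation (random_parents n) (\<lambda>\<pi>. ?s \<pi> v * ?s \<pi> (v + K)))"
    by (rule Bochner_Integration.integral_sum)
       (intro integrable_measure_pmf_finite finite_set_pmf_random_parents)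
  also have "\<dots> \<le> (\<Sum>v\<in>{1..K}. (shallow_prob m (n - 2 * K) (2 * K) {#0#})\<^sup>2)"
    using assms by (intro sum_mono shallow_negatively_correlated) auto
  finally show ?thesis
    by simp
qed

lemma prob_leaf_stripping:
  "measure_pmf.prob (random_recursive_tree n) {G. P (leaf_stripping n k G)} =
    measure_pmf.prob (random_parents n)
      {\<pi>. P (fst ((strip_leaves ^^ nat (height_bound n - int k)) (tree_of n \<pi>)))}"
  by (simp add: random_recursive_tree_eq leaf_stripping_def vimage_def)

lemma prob_compl: "measure_pmf.prob p {x. \<not> P x} = 1 - measure_pmf.prob p {x. P x}"
  using measure_pmf.prob_compl[of "{x. P x}" p] by (simp add: Compl_eq_Diff_UNIV[symmetric] Collect_neg_eq)

theorem theorem2: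
  "\<exists>\<gamma>>0. \<exists>\<epsilon>\<^sub>0>0. \<forall>\<epsilon>::real. 0 < \<epsilon> \<and> \<epsilon> < \<epsilon>\<^sub>0 \<longrightarrow>
     (\<exists>N. \<forall>n\<ge>N. \<forall>k\<ge>1.
        measure_pmf.prob (random_recursive_tree n) {G. 1 \<in> leaf_stripping n k G} \<ge> 1 - \<epsilon> \<longrightarrow>
        measure_pmf.prob (random_recursive_tree n)
          {G. real (card (leaf_stripping n k G)) \<ge> \<epsilon> powr (- \<gamma>)} \<ge> 1 - \<epsilon>)"
proof (rule exI[of _ "1 / 4"], rule conjI, simp, rule exI[of _ "1 / 32 ^ 4"], intro conjI allI impI)
  fix \<epsilon> :: real
  assume \<epsilon>: "0 < \<epsilon> \<and> \<epsilon> < 1 / 32 ^ 4"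
  define x where "x = \<epsilon> powr (- (1 / 4))"
  define K where "K = nat \<lceil>x\<rceil>"
  have "x > 0"
    using \<epsilon> by (simp add: x_def)
  have "x ^ 4 = \<epsilon> powr (- 1)"
    using \<epsilon> by (simp add: x_def powr_power)
  then have x4: "x ^ 4 * \<epsilon> = 1"
    using \<epsilon> by (simp add: powr_minus)
  \<comment> \<open>With \<open>K \<le> 2 * x\<close> the final bound is \<open>32 * \<epsilon> / x\<close>; the threshold for \<open>\<epsilon>\<close> is chosen to make
    this at most \<open>\<epsilon>\<close>.\<close>
  have "x > 32"
  proof (rule ccontr)
    assume "\<not> x > 32"
    then have "x ^ 4 \<le> 32 ^ 4"
      using \<open>x > 0\<close> by (intro power_mono) auto
    then have "x ^ 4 * \<epsilon> \<le> 32 ^ 4 * \<epsilon>"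
      using \<epsilon> by (intro mult_right_mono) auto
    moreover have "32 ^ 4 * \<epsilon> < 1"
      using \<epsilon> by (simp add: field_simps)
    ultimately show False
      using x4 by linarith
  qed
  have K: "x \<le> real K" "real K \<le> 2 * x"
    using \<open>x > 32\<close> by (simp_all add: K_def) linarith+
  have "2 \<le> K"
    using K(1) \<open>x > 32\<close> by linarith
  show "\<exists>N. \<forall>n\<ge>N. \<forall>k\<ge>1.
        measure_pmf.prob (random_recursive_tree n) {G. 1 \<in> leaf_stripping n k G} \<ge> 1 - \<epsilon> \<longrightarrow>
        measure_pmf.prob (random_recursive_tree n)
          {G. real (card (leaf_stripping n k G)) \<ge> \<epsilon> powr (- (1 / 4))} \<ge> 1 - \<epsilon>"
  proof (intro exI[of _ "2 * K"] allI impI)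
    fix n k :: nat
    assume n: "2 * K \<le> n"
      and root: "1 - \<epsilon> \<le> measure_pmf.prob (random_recursive_tree n) {G. 1 \<in> leaf_stripping n k G}"
    define R where "R \<pi> = fst ((strip_leaves ^^ nat (height_bound n - int k)) (tree_of n \<pi>))" for \<pi>
    define q where "q = shallow_prob (nat (height_bound n - int k)) (n - 2 * K) (2 * K) {#0#}"
    have "measure_pmf.prob (random_parents n) {\<pi>. 1 \<notin> R \<pi>} \<le> \<epsilon>"
      using root unfolding prob_leaf_stripping R_def[symmetric] by (simp add: prob_compl)
    have "q \<le> (real (2 * K) - 1) * measure_pmf.prob (random_parents n) {\<pi>. 1 \<notin> R \<pi>}"
      unfolding q_def R_def using \<open>2 \<le> K\<close> n by (intro shallow_prob_le) auto
    also have "\<dots> \<le> real (2 * K) * \<epsilon>"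
      using \<open>measure_pmf.prob _ _ \<le> \<epsilon>\<close> \<open>2 \<le> K\<close> by (intro mult_mono) auto
    finally have q: "q \<le> 2 * real K * \<epsilon>"
      by simp
    have "q = measure_pmf.expectation (random_parents n)
        (\<lambda>\<pi>. 1 * of_bool (shallow (2 * K) (nat (height_bound n - int k)) n \<pi> 1))"
      unfolding q_def using \<open>2 \<le> K\<close> n by (subst shallow_independent_of_start) auto
    then have "0 \<le> q"
      by (simp add: integral_nonneg_AE)
    have "measure_pmf.prob (random_parents n) {\<pi>. \<not> K \<le> card (R \<pi>)} \<le> real K * q\<^sup>2"
      unfolding q_def R_def by (rule prob_few_survivors_le) fact+
    also have "\<dots> \<le> (2 * x) * (2 * (2 * x) * \<epsilon>)\<^sup>2"
      using K q \<open>0 \<le> q\<close> \<epsilon> \<open>x > 0\<close>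
      by (intro mult_mono power_mono order_trans[OF q] mult_right_mono) auto
    also have "\<dots> = 32 * (x ^ 4 * \<epsilon>) * \<epsilon> / x"
      using \<open>x > 0\<close> by (simp add: field_simps power2_eq_square power4_eq_xxxx)
    also have "\<dots> \<le> \<epsilon>"
      using \<open>x > 32\<close> \<epsilon> by (simp add: x4 divide_le_eq)
    finally have "1 - \<epsilon> \<le> measure_pmf.prob (random_parents n) {\<pi>. K \<le> card (R \<pi>)}"
      by (simp add: prob_compl)
    also have "\<dots> \<le> measure_pmf.prob (random_parents n) {\<pi>. x \<le> real (card (R \<pi>))}"
      using K(1) by (intro measure_pmf.finite_measure_mono) auto
    finally show "1 - \<epsilon> \<le> measure_pmf.prob (random_recursive_tree n)
          {G. real (card (leaf_stripping n k G)) \<ge> \<epsilon> powr (- (1 / 4))}"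
      using prob_leaf_stripping[of n "\<lambda>S. x \<le> real (card S)" k] by (simp add: R_def x_def)
  qed
qed auto

end
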